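(* Let $(W_t)_{t\ge0}$ be a scalar Brownian motion and, for any $t>0$, let $(\Pi_n(t))_{n\in\mathbb N}$ be a sequence of finite partitions of $[0,t]$. If $\sum_{n=1}^\infty|\Pi_n(t)|<\infty$, then the quadratic variation satisfies $$\mathrm{Var}_2(W;t)=\lim_{n\to\infty}\sum_{t_i\in\Pi_n(t)}(W_{t_i}-W_{t_{i-1}})^2=t\qquad\mathbb P\text{-a.s.}$$ In particular: (1) For any $t>0$, any positive sequence $(a_n)_{n\in\mathbb N}$ such that $$K_1(t):=\sum_{n=1}^\infty a_n\sum_{m=n}^\infty|\Pi_m(t)|<\infty$$ and any $\varepsilon>0$ we have for $\mathcal S(N)=\sum_{n=1}^Na_n$ with $\mathcal S(0)=0$ that $$\mathbb E[\mathcal S(\mathcal O_\varepsilon(t))]\le\mathbb E[\mathcal S(\mathfrak m_\varepsilon(t))]\le\frac{2t}{\varepsilon^2}\sum_{n=1}^\infty a_n\sum_{m=n}^\infty|\Pi_m(t)|$$ and $$\mathbb P(\mathcal O_\varepsilon(t)\ge k)\le\mathbb P(\mathfrak m_\varepsilon(t)\ge k)\le\frac{K_1(t)}{\mathcal S(k)},\qquad k\in\mathbb N,$$ where $$\mathfrak m_\varepsilon(t):=\sup\Big\{n-1\ \Big|\ n\in\mathbb N,\ \Big|\sum_{i=0}^{k_n-1}(W_{t_{i+1}}-W_{t_i})^2-t\Big|>\varepsilon\Big\},$$ $$\mathcal O_\varepsilon(t):=\#\Big\{n\in\mathbb N\ \Big|\ \Big|\sum_{i=0}^{k_n-1}(W_{t_{i+1}}-W_{t_i})^2-t\Big|>\varepsilon\Big\}.$$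 (2) For any $\theta>1$ and for $\epsilon=(\varepsilon_n)_{n\in\mathbb N}$ with $\varepsilon_n=\sqrt{2t\,n^\theta|\Pi_n(t)|}$ decreasing, we get for all $k\ge1$ $$\mathbb P(\mathcal O_\epsilon(t)\ge k)\le k^{-1}\cdot\zeta(\theta),$$ where $$\mathcal O_\epsilon(t):=\#\Big\{n\in\mathbb N\ \Big|\ \Big|\sum_{i=0}^{k_n-1}(W_{t_{i+1}}-W_{t_i})^2-t\Big|>\varepsilon_n\Big\}.$$ Further, for $$\mathfrak m_\epsilon(t):=\sup\Big\{n-1\ \Big|\ n\in\mathbb N,\ \Big|\sum_{i=0}^{k_n-1}(W_{t_{i+1}}-W_{t_i})^2-t\Big|>\varepsilon_n\Big\}$$ and $-1<p<\theta-2$, we have for all $k\ge1$ $$\mathbb P(\mathcal O_\epsilon(t)\ge k)\le\mathbb P(\mathfrak m_\epsilon(t)\ge k)\le k^{-(p+1)}\big(\theta\,\zeta(\theta-p-1)+\mathbf 1(\{p<0\})\big).$$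
   Context: $\mathbb N=\{1,2,\dots\}$. For each $n$, $\Pi_n(t)$ is given by points $0=t_0<t_1<\dots<t_{k_n}=t$ (depending on $n$), with $k_n\in\mathbb N$, $k_n\nearrow\infty$ as $n\to\infty$, and $|\Pi_n(t)|:=\sup_{i=1,\dots,k_n}(t_i-t_{i-1})$. $\zeta(s)=\sum_{n=1}^\infty n^{-s}$ is Riemann's zeta function; $\mathbf 1(\{p<0\})$ is $1$ if $p<0$ and $0$ otherwise.
   Formalization: The comparison of O with m = sup{n-1 | ...} is false if only n=1 exceeds; it is proved for sup{n | ...}, which also dominates m and obeys the stated upper bounds. The bound K_1(t)/S(k) lacks the factor 2t/ε² and fails as ε→0; it is proved with this factor. *)

theory Defs
  imports "HOL-Probability.Probability" "HOL-Library.Extended_Nat"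
begin

text \<open>
  Only the times \<open>t \<ge> 0\<close> are constrained. The start at 0 and the continuity of paths are
  required almost surely.
\<close>

locale brownian_motion = prob_space M
  for M :: "'a measure" and W :: "real \<Rightarrow> 'a \<Rightarrow> real" +
  assumes measurable_W: "\<And>t. 0 \<le> t \<Longrightarrow> random_variable borel (W t)"
    and start_zero: "AE \<omega> in M. W 0 \<omega> = 0"
    and normal_increments: "\<And>s t. 0 \<le> s \<Longrightarrow> s < t \<Longrightarrow>
      distributed M lborel (\<lambda>\<omega>. W t \<omega> - W s \<omega>) (normal_density 0 (sqrt (t - s)))"
    and indep_increments: "\<And>(\<tau> :: nat \<Rightarrow> real) n. 0 \<le> \<tau> 0 \<Longrightarrow> (\<forall>i<n. \<tau> i < \<tau> (Suc i)) \<Longrightarrow>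
      indep_vars (\<lambda>_. borel) (\<lambda>i \<omega>. W (\<tau> (Suc i)) \<omega> - W (\<tau> i) \<omega>) {..<n}"
    and continuous_paths: "AE \<omega> in M. continuous_on {0..} (\<lambda>t. W t \<omega>)"

text \<open>A partition is given by the number \<open>k\<close> of its intervals and its points \<open>p 0, \<dots>, p k\<close>.\<close>

definition partition_of :: "real \<Rightarrow> nat \<Rightarrow> (nat \<Rightarrow> real) \<Rightarrow> bool" where
  "partition_of t k p \<longleftrightarrow> 1 \<le> k \<and> p 0 = 0 \<and> p k = t \<and> (\<forall>i<k. p i < p (Suc i))"

definition mesh :: "nat \<Rightarrow> (nat \<Rightarrow> real) \<Rightarrow> real" where
  "mesh k p = Max ((\<lambda>i. p i - p (i - 1)) ` {1..k})"

definition square_sum :: "(real \<Rightarrow> 'a \<Rightarrow> real) \<Rightarrow> nat \<Rightarrow> (nat \<Rightarrow> real) \<Rightarrow> 'a \<Rightarrow> real" where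
  "square_sum W k p \<omega> = (\<Sum>i<k. (W (p (Suc i)) \<omega> - W (p i) \<omega>)\<^sup>2)"

text \<open>
  All sequences are indexed by \<open>n \<ge> 1\<close>; their values at 0 are never used. The tolerance may
  depend on \<open>n\<close>.
\<close>

definition exceedances ::
  "(real \<Rightarrow> 'a \<Rightarrow> real) \<Rightarrow> real \<Rightarrow> (nat \<Rightarrow> nat) \<Rightarrow> (nat \<Rightarrow> nat \<Rightarrow> real) \<Rightarrow> (nat \<Rightarrow> real) \<Rightarrow> 'a \<Rightarrow> nat set"
where
  "exceedances W t k p e \<omega> = {n. 1 \<le> n \<and> \<bar>square_sum W (k n) (p n) \<omega> - t\<bar> > e n}"

definition enat_card :: "nat set \<Rightarrow> enat" where
  "enat_card A = (if finite A then enat (card A) else \<infinity>)"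

text \<open>
  Suprema are taken in \<open>enat\<close>, so they are 0 for the empty set and infinite for infinite sets.
  For sets of positive integers, \<open>enat_card A \<le> last_index A\<close>, whereas \<open>enat_card A \<le> last_pred A\<close>
  fails for \<open>A = {1..n}\<close> with \<open>n \<ge> 1\<close>.
\<close>

definition last_pred :: "nat set \<Rightarrow> enat" where
  "last_pred A = (SUP n\<in>A. enat (n - 1))"

definition last_index :: "nat set \<Rightarrow> enat" where
  "last_index A = (SUP n\<in>A. enat n)"

text \<open>\<open>a 1 + \<dots> + a N\<close>, including the value of the whole series at \<open>N = \<infinity>\<close>.\<close>

definition partial_sum :: "(nat \<Rightarrow> real) \<Rightarrow> enat \<Rightarrow> ennreal" where
  "partial_sum a N = (\<Sum>n. if enat (Suc n) \<le> N then ennreal (a (Suc n)) else 0)"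

definition weighted_tails :: "(nat \<Rightarrow> real) \<Rightarrow> (nat \<Rightarrow> real) \<Rightarrow> ennreal" where
  "weighted_tails a b = (\<Sum>n. ennreal (a (Suc n)) * (\<Sum>m. ennreal (b (Suc n + m))))"

text \<open>Riemann's zeta function on the half-line \<open>s > 1\<close>.\<close>

definition zeta :: "real \<Rightarrow> real" where
  "zeta s = (\<Sum>n. real (Suc n) powr (- s))"

end

theory Submission
  imports Defs
begin

text \<open>
  The increments \<open>W (p (i + 1)) - W (p i)\<close> are independent centred Gaussians, so the centred
  squares are independent with second moment \<open>2 (p (i + 1) - p i)\<^sup>2\<close>, and the second moment of
  \<open>square_sum W k p - t\<close> is at most \<open>2 t\<close> times the mesh. Summability of these moments gives
  almost sure convergence. The remaining bounds follow from Chebyshev's inequality, from the fact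
  that the last exceedance is \<open>\<ge> j\<close> iff some exceedance has index \<open>\<ge> j\<close>, and from Markov's
  inequality; for the rate in the second part one splits
  \<open>n powr - \<theta> \<le> j powr - (q + 1) * n powr - (\<theta> - q - 1)\<close> for \<open>n \<ge> j\<close>.
\<close>

section \<open>Size and last element of a set of positive integers\<close>

lemma enat_le_last_index_iff:
  assumes "1 \<le> j"
  shows "enat j \<le> last_index A \<longleftrightarrow> (\<exists>n\<in>A. j \<le> n)"
proof
  assume j: "enat j \<le> last_index A"
  show "\<exists>n\<in>A. j \<le> n"
  proof (rule ccontr)
    assume "\<not> ?thesis"
    \<comment> \<open>With every element below \<open>j\<close>, the supremum is at most
      \<open>j - 1\<close>, which is smaller than \<open>j\<close> only because \<open>j\<close> is
      at least 1. For \<open>j = 0\<close> and empty \<open>A\<close> the equivalence fails, since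
      the supremum of the empty set is 0.\<close>
    then have "last_index A \<le> enat (j - 1)"
      unfolding last_index_def by (intro SUP_least) (auto simp: not_le)
    with j have "enat j \<le> enat (j - 1)"
      by (rule order_trans)
    with assms show False by simp
  qed
next
  assume "\<exists>n\<in>A. j \<le> n"
  then show "enat j \<le> last_index A"
    unfolding last_index_def by (auto intro: SUP_upper2)
qed

text \<open>A finite nonempty \<open>A\<close> without 0 sits inside \<open>{1..Max A}\<close> and
  so has at most \<open>Max A\<close> elements; an infinite \<open>A\<close> is unbounded, which
  makes both sides infinite.\<close>

lemma enat_card_le_last_index:
  assumes "0 \<notin> A"
  shows "enat_card A \<le> last_index A"
proof (cases "finite A \<and> A \<noteq> {}")
  case True
  then have "A \<subseteq> {1..Max A}"
    using assms by (auto simp: Suc_le_eq intro: gr0I)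
  then have "card A \<le> Max A"
    using card_mono[of "{1..Max A}" A] by simp
  then show ?thesis
    using True unfolding last_index_def enat_card_def
    by (auto intro!: SUP_upper2[OF Max_in])
next
  case False
  have "last_index A = \<infinity>" if inf: "infinite A"
  proof (rule ccontr)
    assume "last_index A \<noteq> \<infinity>"
    then obtain m where m: "last_index A = enat m" by auto
    obtain n where "n \<in> A" "Suc m \<le> n"
      using inf by (meson infinite_nat_iff_unbounded_le)
    then have "enat (Suc m) \<le> last_index A"
      by (subst enat_le_last_index_iff) auto
    with m show False by simp
  qed
  with False show ?thesis
    by (auto simp: enat_card_def zero_enat_def[symmetric])
qed

text \<open>Together with \<open>enat_card_le_last_index\<close> this makes
  \<open>last_index\<close> a common upper bound of \<open>enat_card\<close> and
  \<open>last_pred\<close> on sets of positive integers, so upper bounds for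
  \<open>last_index\<close> pass to both.\<close>

lemma last_pred_le_last_index: "last_pred A \<le> last_index A"
  unfolding last_pred_def last_index_def by (intro SUP_mono) (auto intro: diff_le_self)

lemma partial_sum_mono: "N \<le> N' \<Longrightarrow> partial_sum a N \<le> partial_sum a N'"
  unfolding partial_sum_def by (intro suminf_le) (auto dest: order_trans)

lemma partial_sum_enat: "partial_sum a (enat j) = (\<Sum>n<j. ennreal (a (Suc n)))"
  unfolding partial_sum_def
  by (subst suminf_finite[of "{..<j}"]) (auto simp: Suc_le_eq)

text \<open>Replaces a possibly infinite cardinality by a series of indicators, which can be
  integrated term by term: any \<open>j\<close> elements of \<open>A\<close> already contribute
  \<open>j\<close> to the series.\<close>

lemma of_nat_le_suminf_indicator:
  assumes "0 \<notin> A" "enat j \<le> enat_card A"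
  shows "(of_nat j :: ennreal) \<le> (\<Sum>n. indicator A (Suc n))"
proof -
  obtain B where B: "B \<subseteq> A" "card B = j" "finite B"
  proof (cases "finite A")
    case True
    then show ?thesis
      using assms(2) that by (auto simp: enat_card_def elim: obtain_subset_with_card_n)
  next
    case False
    then show ?thesis
      using infinite_arbitrarily_large[of A j] that by auto
  qed
  \<comment> \<open>The series is indexed by predecessors, so \<open>B\<close> is shifted down by
    one. The shift is injective because truncated subtraction could only merge 0 with 1, and 0 is
    not in \<open>A\<close>.\<close>
  have inj: "inj_on (\<lambda>n. n - 1) B"
    using B assms(1) by (intro inj_on_diff_nat) (metis Suc_le_eq gr0I subsetD One_nat_def)
  have "(of_nat j :: ennreal) = (\<Sum>n\<in>B. indicator A (Suc (n - 1)))"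
  proof -
    have "indicator A (Suc (n - 1)) = (1 :: ennreal)" if "n \<in> B" for n
      using that B assms(1) by (cases n) auto
    then show ?thesis
      using B by simp
  qed
  also have "\<dots> = (\<Sum>n\<in>(\<lambda>n. n - 1) ` B. indicator A (Suc n))"
    by (subst sum.reindex[OF inj]) simp
  also have "\<dots> \<le> (\<Sum>n. indicator A (Suc n))"
    using B by (intro sum_le_suminf) auto
  finally show ?thesis .
qed

section \<open>Tail bounds for random index sets\<close>

context prob_space
begin

context
  fixes A :: "'a \<Rightarrow> nat set"
  assumes A [measurable]: "\<And>n. {\<omega> \<in> space M. n \<in> A \<omega>} \<in> events"
begin

text \<open>Writing the tail event as a countable union yields both its measurability and the union
  bound.\<close>

lemma last_index_ge_event:
  assumes "1 \<le> j"
  shows "{\<omega> \<in> space M. enat j \<le> last_index (A \<omega>)} = (\<Union>m. {\<omega> \<in> space M. j + m \<in> A \<omega>})"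
  unfolding enat_le_last_index_iff[OF assms] by (auto simp: le_iff_add)

lemma sets_last_index_ge:
  assumes "1 \<le> j"
  shows "{\<omega> \<in> space M. enat j \<le> last_index (A \<omega>)} \<in> events"
  using last_index_ge_event[OF assms] by auto

lemma emeasure_last_index_ge:
  assumes "1 \<le> j"
  shows "emeasure M {\<omega> \<in> space M. enat j \<le> last_index (A \<omega>)}
    \<le> (\<Sum>m. emeasure M {\<omega> \<in> space M. j + m \<in> A \<omega>})"
  unfolding last_index_ge_event[OF assms] by (rule emeasure_subadditive_countably) auto

text \<open>Interchanging sum and integral turns the expectation into a sum of tail probabilities
  weighted by \<open>a\<close>. The union bound replaces each of them by \<open>c\<close> times a
  tail sum of \<open>b\<close>, which is the shape of \<open>weighted_tails\<close>. In the
  application \<open>c\<close> is the constant of Chebyshev's inequality.\<close>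

lemma nn_integral_partial_sum_last_index:
  assumes b: "\<And>n. 1 \<le> n \<Longrightarrow> emeasure M {\<omega> \<in> space M. n \<in> A \<omega>} \<le> c * ennreal (b n)"
  shows "(\<integral>\<^sup>+\<omega>. partial_sum a (last_index (A \<omega>)) \<partial>M) \<le> c * weighted_tails a b"
proof -
  let ?L = "\<lambda>n. {\<omega> \<in> space M. enat (Suc n) \<le> last_index (A \<omega>)}"
  have L [measurable]: "?L n \<in> events" for n
    by (rule sets_last_index_ge) simp
  have "(\<integral>\<^sup>+\<omega>. partial_sum a (last_index (A \<omega>)) \<partial>M)
      = (\<integral>\<^sup>+\<omega>. (\<Sum>n. ennreal (a (Suc n)) * indicator (?L n) \<omega>) \<partial>M)"
    unfolding partial_sum_def
    by (intro nn_integral_cong arg_cong[where f = suminf] ext) (auto simp: indicator_def)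
  also have "\<dots> = (\<Sum>n. ennreal (a (Suc n)) * emeasure M (?L n))"
    by (subst nn_integral_suminf) (auto simp: nn_integral_cmult)
  also have "\<dots> \<le> (\<Sum>n. ennreal (a (Suc n)) * (\<Sum>m. c * ennreal (b (Suc n + m))))"
  proof (intro suminf_le mult_left_mono)
    fix n
    have "emeasure M (?L n) \<le> (\<Sum>m. emeasure M {\<omega> \<in> space M. Suc n + m \<in> A \<omega>})"
      by (rule emeasure_last_index_ge) simp
    also have "\<dots> \<le> (\<Sum>m. c * ennreal (b (Suc n + m)))"
      by (intro suminf_le b) auto
    finally show "emeasure M (?L n) \<le> (\<Sum>m. c * ennreal (b (Suc n + m)))" .
  qed auto
  also have "\<dots> = c * weighted_tails a b"
    by (simp add: weighted_tails_def mult.left_commute)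
  finally show ?thesis .
qed

text \<open>Markov's inequality after applying the monotone function \<open>partial_sum a\<close> to
  the last index.\<close>

lemma emeasure_last_index_ge_partial_sum:
  assumes a: "\<And>n. 1 \<le> n \<Longrightarrow> 0 < a n" and j: "1 \<le> j"
  shows "emeasure M {\<omega> \<in> space M. enat j \<le> last_index (A \<omega>)}
    \<le> (\<integral>\<^sup>+\<omega>. partial_sum a (last_index (A \<omega>)) \<partial>M) / partial_sum a (enat j)"
proof -
  let ?S = "partial_sum a (enat j)"
  let ?L = "{\<omega> \<in> space M. enat j \<le> last_index (A \<omega>)}"
  \<comment> \<open>Cancelling \<open>?S\<close> in \<open>ennreal\<close> requires it to be neither
    0 nor infinite. Its first term is positive because \<open>j\<close> is at least 1, and it is a
    finite sum of finite terms.\<close>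
  have "0 < a (Suc 0)" using a by simp
  then have "?S \<noteq> 0" using j by (auto simp: partial_sum_enat intro!: bexI[of _ 0])
  moreover have "?S \<noteq> \<top>"
    by (simp add: partial_sum_enat)
  moreover have "?S * emeasure M ?L \<le> (\<integral>\<^sup>+\<omega>. partial_sum a (last_index (A \<omega>)) \<partial>M)"
  proof -
    have "?S * emeasure M ?L = (\<integral>\<^sup>+\<omega>. ?S * indicator ?L \<omega> \<partial>M)"
      using sets_last_index_ge[OF j] by (simp add: nn_integral_cmult)
    also have "\<dots> \<le> (\<integral>\<^sup>+\<omega>. partial_sum a (last_index (A \<omega>)) \<partial>M)"
      by (intro nn_integral_mono) (auto simp: indicator_def intro: partial_sum_mono)
    finally show ?thesis .
  qed
  then have "?S * emeasure M ?L / ?S \<le> (\<integral>\<^sup>+\<omega>. partial_sum a (last_index (A \<omega>)) \<partial>M) / ?S"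
    by (rule divide_right_mono_ennreal)
  ultimately show ?thesis
    by (metis ennreal_mult_divide_eq mult.commute)
qed

text \<open>Markov's inequality for the number of elements, kept as a product so that no division by
  \<open>j\<close> arises in \<open>ennreal\<close>.\<close>

lemma emeasure_enat_card_ge:
  assumes "\<And>\<omega>. 0 \<notin> A \<omega>"
  shows "of_nat j * emeasure M {\<omega> \<in> space M. enat j \<le> enat_card (A \<omega>)}
    \<le> (\<Sum>n. emeasure M {\<omega> \<in> space M. Suc n \<in> A \<omega>})"
proof -
  \<comment> \<open>The counting event is enclosed in an event that is measurable by construction;
    monotonicity of \<open>emeasure\<close> asks for measurability of the larger set only.\<close>
  let ?C = "{\<omega> \<in> space M. of_nat j \<le> (\<Sum>n. indicator {\<omega> \<in> space M. Suc n \<in> A \<omega>} \<omega> :: ennreal)}"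
  have C: "?C \<in> events" by measurable
  have "emeasure M {\<omega> \<in> space M. enat j \<le> enat_card (A \<omega>)} \<le> emeasure M ?C"
  proof (rule emeasure_mono[OF _ C], safe)
    fix \<omega> assume "\<omega> \<in> space M" "enat j \<le> enat_card (A \<omega>)"
    then show "of_nat j \<le> (\<Sum>n. indicator {\<omega> \<in> space M. Suc n \<in> A \<omega>} \<omega> :: ennreal)"
      using of_nat_le_suminf_indicator[OF assms, of j \<omega>] by (simp add: indicator_def)
  qed
  then have "of_nat j * emeasure M {\<omega> \<in> space M. enat j \<le> enat_card (A \<omega>)}
      \<le> of_nat j * emeasure M ?C"
    by (intro mult_left_mono) auto
  also have "\<dots> = (\<integral>\<^sup>+\<omega>. of_nat j * indicator ?C \<omega> \<partial>M)"
    using C by (simp add: nn_integral_cmult)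
  also have "\<dots> \<le> (\<integral>\<^sup>+\<omega>. (\<Sum>n. indicator {\<omega> \<in> space M. Suc n \<in> A \<omega>} \<omega>) \<partial>M)"
    by (intro nn_integral_mono) (auto simp: indicator_def[of ?C])
  also have "\<dots> = (\<Sum>n. emeasure M {\<omega> \<in> space M. Suc n \<in> A \<omega>})"
    by (subst nn_integral_suminf) auto
  finally show ?thesis .
qed

end

section \<open>Second moments of independent sums and of centred Gaussian squares\<close>

lemma indep_vars_sum_second_moment:
  fixes X :: "'i \<Rightarrow> 'a \<Rightarrow> real"
  assumes "finite I" "indep_vars (\<lambda>_. borel) X I"
    and "\<And>i. i \<in> I \<Longrightarrow> integrable M (\<lambda>\<omega>. (X i \<omega>)\<^sup>2)"
    and "\<And>i. i \<in> I \<Longrightarrow> expectation (X i) = 0"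
  shows "integrable M (\<lambda>\<omega>. (\<Sum>i\<in>I. X i \<omega>)\<^sup>2)
    \<and> expectation (\<lambda>\<omega>. (\<Sum>i\<in>I. X i \<omega>)\<^sup>2) = (\<Sum>i\<in>I. expectation (\<lambda>\<omega>. (X i \<omega>)\<^sup>2))"
  using assms
proof (induction I rule: finite_induct)
  case empty
  then show ?case by simp
next
  case (insert i I)
  define S where "S = (\<lambda>\<omega>. \<Sum>i\<in>I. X i \<omega>)"
  have meas: "X l \<in> borel_measurable M" if "l \<in> insert i I" for l
    using insert.prems(1) that by (auto simp: indep_vars_def)
  then have [measurable]: "S \<in> borel_measurable M"
    unfolding S_def by (intro borel_measurable_sum) auto
  have IH: "integrable M (\<lambda>\<omega>. (S \<omega>)\<^sup>2)"
    "expectation (\<lambda>\<omega>. (S \<omega>)\<^sup>2) = (\<Sum>i\<in>I. expectation (\<lambda>\<omega>. (X i \<omega>)\<^sup>2))"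
    using insert.IH[OF indep_vars_subset[OF insert.prems(1) subset_insertI] insert.prems(2,3)]
    by (simp_all add: S_def)
  have intX: "integrable M (X i)"
    by (rule square_integrable_imp_integrable) (use insert.prems(2) meas in simp_all)
  have intS: "integrable M S"
    by (rule square_integrable_imp_integrable) (use IH(1) in simp_all)
  have indep: "indep_var borel (X i) borel S"
    unfolding S_def by (rule indep_vars_sum[OF insert.hyps insert.prems(1)])
  \<comment> \<open>The cross term factorises because \<open>X i\<close> is independent of the
    partial sum \<open>S\<close>, and it vanishes because \<open>X i\<close> has mean 0. Hence
    second moments add.\<close>
  have prod: "integrable M (\<lambda>\<omega>. X i \<omega> * S \<omega>)" "expectation (\<lambda>\<omega>. X i \<omega> * S \<omega>) = 0"
    using indep_var_integrable[OF indep intX intS] indep_var_lebesgue_integral[OF indep intX intS]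
      insert.prems(3)[of i] by simp_all
  have eq: "(\<lambda>\<omega>. (\<Sum>i\<in>insert i I. X i \<omega>)\<^sup>2) = (\<lambda>\<omega>. (X i \<omega>)\<^sup>2 + 2 * (X i \<omega> * S \<omega>) + (S \<omega>)\<^sup>2)"
    using insert.hyps by (simp add: S_def power2_eq_square algebra_simps)
  have Xi: "integrable M (\<lambda>\<omega>. (X i \<omega>)\<^sup>2)"
    using insert.prems(2) by simp
  then have exp: "expectation (\<lambda>\<omega>. (X i \<omega>)\<^sup>2 + 2 * (X i \<omega> * S \<omega>) + (S \<omega>)\<^sup>2)
      = expectation (\<lambda>\<omega>. (X i \<omega>)\<^sup>2) + expectation (\<lambda>\<omega>. (S \<omega>)\<^sup>2)"
    using IH(1) prod by simp
  show ?case
    unfolding eq exp unfolding sum.insert[OF insert.hyps] IH(2) using Xi IH(1) prod(1) by simp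
qed

lemma normal_square_centred:
  fixes X :: "'a \<Rightarrow> real"
  assumes D: "distributed M lborel X (normal_density 0 \<sigma>)" and \<sigma>: "0 < \<sigma>"
  shows "expectation (\<lambda>\<omega>. (X \<omega>)\<^sup>2 - \<sigma>\<^sup>2) = 0"
    and "integrable M (\<lambda>\<omega>. ((X \<omega>)\<^sup>2 - \<sigma>\<^sup>2)\<^sup>2)"
    and "expectation (\<lambda>\<omega>. ((X \<omega>)\<^sup>2 - \<sigma>\<^sup>2)\<^sup>2) = 2 * \<sigma> ^ 4"
proof -
  have int: "integrable M (\<lambda>\<omega>. X \<omega> ^ n)" for n
    using distributed_integrable[OF D, of "\<lambda>x. x ^ n"] integrable_normal_moment[OF \<sigma>, of 0 n] \<sigma>
    by simp
  \<comment> \<open>The even Gaussian moments: \<open>n = 1\<close> gives the variance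
    \<open>\<sigma>\<^sup>2\<close> and \<open>n = 2\<close> gives \<open>3 * \<sigma> ^ 4\<close>.
    Expanding the square then leaves the factor 3 - 2 + 1 = 2.\<close>
  have even: "expectation (\<lambda>\<omega>. X \<omega> ^ (2 * n)) = fact (2 * n) / ((2 / \<sigma>\<^sup>2) ^ n * fact n)" for n
    using distributed_integral[OF D, of "\<lambda>x. x ^ (2 * n)"] integral_normal_moment_even[OF \<sigma>, of 0 n] \<sigma>
    by simp
  have 2: "expectation (\<lambda>\<omega>. (X \<omega>)\<^sup>2) = \<sigma>\<^sup>2"
    using even[of 1] by (simp add: fact_numeral)
  have 4: "expectation (\<lambda>\<omega>. X \<omega> ^ 4) = 3 * \<sigma> ^ 4"
    using even[of 2] \<sigma> by (simp add: fact_numeral power_divide)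
  show "expectation (\<lambda>\<omega>. (X \<omega>)\<^sup>2 - \<sigma>\<^sup>2) = 0"
    using int[of 2] 2 by (simp add: prob_space)
  have eq: "(\<lambda>\<omega>. ((X \<omega>)\<^sup>2 - \<sigma>\<^sup>2)\<^sup>2) = (\<lambda>\<omega>. X \<omega> ^ 4 - 2 * \<sigma>\<^sup>2 * (X \<omega>)\<^sup>2 + \<sigma> ^ 4)"
    by (simp add: power2_eq_square power4_eq_xxxx algebra_simps)
  show "integrable M (\<lambda>\<omega>. ((X \<omega>)\<^sup>2 - \<sigma>\<^sup>2)\<^sup>2)"
    unfolding eq using int[of 2] int[of 4] by auto
  have "expectation (\<lambda>\<omega>. ((X \<omega>)\<^sup>2 - \<sigma>\<^sup>2)\<^sup>2) = 3 * \<sigma> ^ 4 - 2 * \<sigma>\<^sup>2 * \<sigma>\<^sup>2 + \<sigma> ^ 4"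
    unfolding eq using int[of 2] int[of 4] 2 4 by (simp add: prob_space)
  also have "\<dots> = 2 * \<sigma> ^ 4"
    by (simp add: power2_eq_square power4_eq_xxxx)
  finally show "expectation (\<lambda>\<omega>. ((X \<omega>)\<^sup>2 - \<sigma>\<^sup>2)\<^sup>2) = 2 * \<sigma> ^ 4" .
qed

end

section \<open>Partitions and their mesh\<close>

lemma partition_of_nonneg:
  assumes "partition_of t k p" "i \<le> k"
  shows "0 \<le> p i"
  using assms(2)
proof (induction i)
  case 0
  then show ?case using assms by (simp add: partition_of_def)
next
  case (Suc i)
  then have "p i < p (Suc i)" using assms by (simp add: partition_of_def)
  with Suc show ?case by simp
qed

lemma diff_le_mesh: "i < k \<Longrightarrow> p (Suc i) - p i \<le> mesh k p"
  unfolding mesh_def by (intro Max_ge) (auto intro!: image_eqI[of _ _ "Suc i"])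

lemma mesh_pos:
  assumes "partition_of t k p"
  shows "0 < mesh k p"
proof -
  have "0 < k" "p 0 < p (Suc 0)" using assms by (auto simp: partition_of_def)
  with diff_le_mesh[of 0 k p] show ?thesis by simp
qed

lemma sum_partition:
  assumes "partition_of t k p"
  shows "(\<Sum>i<k. p (Suc i) - p i) = t"
  using assms by (simp add: sum_lessThan_telescope partition_of_def)

section \<open>Square sums of Brownian increments\<close>

context brownian_motion
begin

lemma square_sum_measurable:
  assumes "partition_of t k p"
  shows "square_sum W k p \<in> borel_measurable M"
proof -
  have "W (p i) \<in> borel_measurable M" if "i \<le> k" for i
    using measurable_W partition_of_nonneg[OF assms that] .
  then show ?thesis
    unfolding square_sum_def[abs_def]
    by (intro borel_measurable_sum borel_measurable_power borel_measurable_diff) auto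
qed

lemma square_sum_second_moment:
  assumes p: "partition_of t k p"
  shows "integrable M (\<lambda>\<omega>. (square_sum W k p \<omega> - t)\<^sup>2)"
    and "expectation (\<lambda>\<omega>. (square_sum W k p \<omega> - t)\<^sup>2) \<le> 2 * t * mesh k p"
proof -
  define d where "d i = p (Suc i) - p i" for i
  define X where "X i \<omega> = (W (p (Suc i)) \<omega> - W (p i) \<omega>)\<^sup>2 - d i" for i \<omega>
  have d: "0 < d i" if "i < k" for i
    using p that by (simp add: partition_of_def d_def)
  have D: "distributed M lborel (\<lambda>\<omega>. W (p (Suc i)) \<omega> - W (p i) \<omega>) (normal_density 0 (sqrt (d i)))"
    if "i < k" for i
    unfolding d_def using p that partition_of_nonneg[OF p, of i]
    by (intro normal_increments) (auto simp: partition_of_def)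
  have X: "expectation (X i) = 0" "integrable M (\<lambda>\<omega>. (X i \<omega>)\<^sup>2)"
    "expectation (\<lambda>\<omega>. (X i \<omega>)\<^sup>2) = 2 * (d i)\<^sup>2" if "i < k" for i
  proof -
    have "sqrt (d i) ^ 4 = (d i)\<^sup>2"
      using power_mult[of "sqrt (d i)" 2 2] d[OF that] by simp
    then show "expectation (X i) = 0" "integrable M (\<lambda>\<omega>. (X i \<omega>)\<^sup>2)"
      "expectation (\<lambda>\<omega>. (X i \<omega>)\<^sup>2) = 2 * (d i)\<^sup>2"
      using normal_square_centred[OF D[OF that]] d[OF that] by (auto simp: X_def[abs_def])
  qed
  have "indep_vars (\<lambda>_. borel) (\<lambda>i \<omega>. W (p (Suc i)) \<omega> - W (p i) \<omega>) {..<k}"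
    using p by (intro indep_increments) (auto simp: partition_of_def)
  \<comment> \<open>Each \<open>X i\<close> is a fixed measurable function of the
    \<open>i\<close>-th increment, so independence is inherited.\<close>
  then have "indep_vars (\<lambda>_. borel) X {..<k}"
    unfolding X_def[abs_def] by (rule indep_vars_compose2) measurable
  from indep_vars_sum_second_moment[OF _ this] X
  have *: "integrable M (\<lambda>\<omega>. (\<Sum>i<k. X i \<omega>)\<^sup>2)"
    "expectation (\<lambda>\<omega>. (\<Sum>i<k. X i \<omega>)\<^sup>2) = (\<Sum>i<k. 2 * (d i)\<^sup>2)"
    by auto
  \<comment> \<open>The interval lengths add up to \<open>t\<close>, so centring every square by its
    \<open>d i\<close> centres the whole sum by \<open>t\<close>.\<close>
  have eq: "(\<Sum>i<k. X i \<omega>) = square_sum W k p \<omega> - t" for \<omega>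
    using sum_partition[OF p] by (simp add: X_def square_sum_def sum_subtractf d_def)
  show "integrable M (\<lambda>\<omega>. (square_sum W k p \<omega> - t)\<^sup>2)"
    using * by (simp add: eq)
  \<comment> \<open>One factor \<open>d i\<close> is bounded by the mesh; the other is kept and sums
    to \<open>t\<close>.\<close>
  have "(\<Sum>i<k. 2 * (d i)\<^sup>2) \<le> (\<Sum>i<k. 2 * mesh k p * d i)"
  proof (intro sum_mono)
    fix i assume "i \<in> {..<k}"
    then have "d i \<le> mesh k p" "0 < d i"
      using diff_le_mesh d by (auto simp: d_def)
    then show "2 * (d i)\<^sup>2 \<le> 2 * mesh k p * d i"
      by (simp add: power2_eq_square)
  qed
  also have "\<dots> = 2 * t * mesh k p"
    using sum_partition[OF p] by (simp add: d_def flip: sum_distrib_left)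
  finally show "expectation (\<lambda>\<omega>. (square_sum W k p \<omega> - t)\<^sup>2) \<le> 2 * t * mesh k p"
    using * by (simp add: eq)
qed

lemma square_sum_Chebyshev:
  assumes p: "partition_of t k p" and \<epsilon>: "0 < \<epsilon>"
  shows "prob {\<omega> \<in> space M. \<bar>square_sum W k p \<omega> - t\<bar> > \<epsilon>} \<le> 2 * t / \<epsilon>\<^sup>2 * mesh k p"
proof -
  note [measurable] = square_sum_measurable[OF p]
  have "prob {\<omega> \<in> space M. \<bar>square_sum W k p \<omega> - t\<bar> > \<epsilon>}
      \<le> prob {\<omega> \<in> space M. \<bar>square_sum W k p \<omega> - t\<bar> \<ge> \<epsilon>}"
    by (intro finite_measure_mono) auto
  also have "\<dots> \<le> expectation (\<lambda>\<omega>. (square_sum W k p \<omega> - t)\<^sup>2) / \<epsilon>\<^sup>2"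
    using square_sum_second_moment(1)[OF p] \<epsilon> by (intro second_moment_method) auto
  also have "\<dots> \<le> 2 * t * mesh k p / \<epsilon>\<^sup>2"
    using square_sum_second_moment(2)[OF p] by (intro divide_right_mono) auto
  finally show ?thesis by simp
qed

text \<open>The series of squared deviations has finite expectation, hence is finite almost surely,
  and the terms of a convergent series tend to 0. No Borel-Cantelli argument over varying tolerances
  is involved.\<close>

lemma AE_square_sum_tendsto:
  assumes p: "\<And>n. partition_of t (k n) (p n)" and sm: "summable (\<lambda>n. mesh (k n) (p n))"
  shows "AE \<omega> in M. (\<lambda>n. square_sum W (k n) (p n) \<omega>) \<longlonglongrightarrow> t"
proof -
  note [measurable] = square_sum_measurable[OF p]
  let ?f = "\<lambda>n \<omega>. (square_sum W (k n) (p n) \<omega> - t)\<^sup>2"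
  have mom: "(\<integral>\<^sup>+\<omega>. ennreal (?f n \<omega>) \<partial>M) \<le> ennreal (2 * t * mesh (k n) (p n))" for n
    using square_sum_second_moment[OF p, of n]
    by (subst nn_integral_eq_integral) (auto intro: ennreal_leI)
  have "(\<integral>\<^sup>+\<omega>. (\<Sum>n. ennreal (?f n \<omega>)) \<partial>M) = (\<Sum>n. \<integral>\<^sup>+\<omega>. ennreal (?f n \<omega>) \<partial>M)"
    by (rule nn_integral_suminf) measurable
  also have "\<dots> \<le> (\<Sum>n. ennreal (2 * t * mesh (k n) (p n)))"
    by (intro suminf_le mom) auto
  also have "\<dots> < \<top>"
    unfolding less_top[symmetric]
  proof (rule ennreal_suminf_neq_top)
    show "summable (\<lambda>n. 2 * t * mesh (k n) (p n))"
      using sm by (rule summable_mult)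
    show "0 \<le> 2 * t * mesh (k n) (p n)" for n
      \<comment> \<open>Nonnegativity of \<open>t\<close> is read off from the last partition point,
        \<open>p n (k n) = t\<close>.\<close>
      using mesh_pos[OF p, of n] partition_of_nonneg[OF p, of "k n" n] p[of n]
      by (simp add: partition_of_def)
  qed
  finally have "(\<integral>\<^sup>+\<omega>. (\<Sum>n. ennreal (?f n \<omega>)) \<partial>M) \<noteq> \<infinity>"
    by simp
  then have "AE \<omega> in M. (\<Sum>n. ennreal (?f n \<omega>)) \<noteq> \<infinity>"
    by (intro nn_integral_PInf_AE) measurable
  then show ?thesis
  proof eventually_elim
    case (elim \<omega>)
    then have "summable (\<lambda>n. ?f n \<omega>)"
      by (intro summable_suminf_not_top) auto
    then have "(\<lambda>n. ?f n \<omega>) \<longlonglongrightarrow> 0"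
      by (rule summable_LIMSEQ_zero)
    then have "(\<lambda>n. square_sum W (k n) (p n) \<omega> - t) \<longlonglongrightarrow> 0"
      by simp
    then show ?case
      by (simp add: LIM_zero_iff)
  qed
qed

end

section \<open>Tails of the zeta series\<close>

lemma summable_zeta: "1 < s \<Longrightarrow> summable (\<lambda>n. real (Suc n) powr - s)"
  using summable_real_powr_iff[of "- s"] summable_Suc_iff[of "\<lambda>n. real n powr - s"] by simp

lemma zeta_nonneg: "1 < s \<Longrightarrow> 0 \<le> zeta s"
  unfolding zeta_def by (intro suminf_nonneg summable_zeta) auto

lemma suminf_powr_eq_zeta: "1 < s \<Longrightarrow> (\<Sum>n. ennreal (real (Suc n) powr - s)) = ennreal (zeta s)"
  unfolding zeta_def by (intro suminf_ennreal2 summable_zeta) auto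

text \<open>The power is split into exponents \<open>- r\<close> and \<open>- (s - r)\<close>. The
  base \<open>j + m\<close> is at least \<open>j\<close>, used in the first factor, and at least
  \<open>m + 1\<close> since \<open>j\<close> is positive, used in the second; the second factors
  sum to a full zeta series.\<close>

lemma suminf_powr_tail_le:
  assumes "1 \<le> j" "0 \<le> r" "1 < s - r"
  shows "(\<Sum>m. ennreal (real (j + m) powr - s)) \<le> ennreal (real j powr - r * zeta (s - r))"
proof -
  have "(\<Sum>m. ennreal (real (j + m) powr - s))
      \<le> (\<Sum>m. ennreal (real j powr - r) * ennreal (real (Suc m) powr - (s - r)))"
  proof (intro suminf_le)
    fix m
    have "real (j + m) powr - s = real (j + m) powr - r * real (j + m) powr - (s - r)"
      by (simp flip: powr_add)
    also have "\<dots> \<le> real j powr - r * real (Suc m) powr - (s - r)"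
      using assms by (intro mult_mono powr_mono2') auto
    finally show "ennreal (real (j + m) powr - s)
        \<le> ennreal (real j powr - r) * ennreal (real (Suc m) powr - (s - r))"
      by (simp add: ennreal_leI flip: ennreal_mult)
  qed auto
  also have "\<dots> = ennreal (real j powr - r) * ennreal (zeta (s - r))"
    by (simp only: ennreal_suminf_cmult suminf_powr_eq_zeta[OF assms(3)])
  finally show ?thesis
    using zeta_nonneg[OF assms(3)] by (simp add: ennreal_mult)
qed

section \<open>Exceedances of the Brownian square sums\<close>

theorem theorem8:
  fixes M :: "'a measure" and W :: "real \<Rightarrow> 'a \<Rightarrow> real"
    and t :: real and k :: "nat \<Rightarrow> nat" and p :: "nat \<Rightarrow> nat \<Rightarrow> real"
  assumes "brownian_motion M W"
    and "t > 0"
    and "\<forall>n\<ge>1. partition_of t (k n) (p n)"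
    and "\<forall>m n. 1 \<le> m \<and> m \<le> n \<longrightarrow> k m \<le> k n"
    and "filterlim k at_top sequentially"
    and "summable (\<lambda>n. mesh (k (Suc n)) (p (Suc n)))"
  shows
    "(AE \<omega> in M. (\<lambda>n. square_sum W (k n) (p n) \<omega>) \<longlonglongrightarrow> t)
     \<and>
     (\<forall>(a :: nat \<Rightarrow> real) (\<epsilon> :: real).
        (\<forall>n\<ge>1. a n > 0) \<and> weighted_tails a (\<lambda>n. mesh (k n) (p n)) < \<infinity> \<and> \<epsilon> > 0 \<longrightarrow>
          (\<integral>\<^sup>+\<omega>. partial_sum a (enat_card (exceedances W t k p (\<lambda>_. \<epsilon>) \<omega>)) \<partial>M)
            \<le> (\<integral>\<^sup>+\<omega>. partial_sum a (last_index (exceedances W t k p (\<lambda>_. \<epsilon>) \<omega>)) \<partial>M)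
        \<and> (\<integral>\<^sup>+\<omega>. partial_sum a (last_pred (exceedances W t k p (\<lambda>_. \<epsilon>) \<omega>)) \<partial>M)
            \<le> (\<integral>\<^sup>+\<omega>. partial_sum a (last_index (exceedances W t k p (\<lambda>_. \<epsilon>) \<omega>)) \<partial>M)
        \<and> (\<integral>\<^sup>+\<omega>. partial_sum a (last_index (exceedances W t k p (\<lambda>_. \<epsilon>) \<omega>)) \<partial>M)
            \<le> ennreal (2 * t / \<epsilon>\<^sup>2) * weighted_tails a (\<lambda>n. mesh (k n) (p n))
        \<and> (\<forall>j\<ge>1.
              emeasure M {\<omega> \<in> space M. enat_card (exceedances W t k p (\<lambda>_. \<epsilon>) \<omega>) \<ge> enat j}
                \<le> emeasure M {\<omega> \<in> space M. last_index (exceedances W t k p (\<lambda>_. \<epsilon>) \<omega>) \<ge> enat j}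
            \<and> emeasure M {\<omega> \<in> space M. last_pred (exceedances W t k p (\<lambda>_. \<epsilon>) \<omega>) \<ge> enat j}
                \<le> emeasure M {\<omega> \<in> space M. last_index (exceedances W t k p (\<lambda>_. \<epsilon>) \<omega>) \<ge> enat j}
            \<and> emeasure M {\<omega> \<in> space M. last_index (exceedances W t k p (\<lambda>_. \<epsilon>) \<omega>) \<ge> enat j}
                \<le> ennreal (2 * t / \<epsilon>\<^sup>2) * weighted_tails a (\<lambda>n. mesh (k n) (p n)) / partial_sum a (enat j)))
     \<and>
     (\<forall>(\<theta> :: real) (e :: nat \<Rightarrow> real).
        \<theta> > 1 \<and> (\<forall>n\<ge>1. e n = sqrt (2 * t * real n powr \<theta> * mesh (k n) (p n)))
          \<and> (\<forall>m n. 1 \<le> m \<and> m \<le> n \<longrightarrow> e n \<le> e m) \<longrightarrow>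
          (\<forall>j\<ge>1. measure M {\<omega> \<in> space M. enat_card (exceedances W t k p e \<omega>) \<ge> enat j} \<le> zeta \<theta> / real j)
        \<and> (\<forall>q :: real. -1 < q \<and> q < \<theta> - 2 \<longrightarrow>
             (\<forall>j\<ge>1.
                measure M {\<omega> \<in> space M. enat_card (exceedances W t k p e \<omega>) \<ge> enat j}
                  \<le> measure M {\<omega> \<in> space M. last_index (exceedances W t k p e \<omega>) \<ge> enat j}
              \<and> measure M {\<omega> \<in> space M. last_pred (exceedances W t k p e \<omega>) \<ge> enat j}
                  \<le> measure M {\<omega> \<in> space M. last_index (exceedances W t k p e \<omega>) \<ge> enat j}
              \<and> measure M {\<omega> \<in> space M. last_index (exceedances W t k p e \<omega>) \<ge> enat j}
                  \<le> real j powr (- (q + 1)) * (\<theta> * zeta (\<theta> - q - 1) + (if q < 0 then 1 else 0)))))"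
proof -
  interpret brownian_motion M W by fact
  let ?A = "\<lambda>e \<omega>. exceedances W t k p e \<omega>"
  have part: "partition_of t (k n) (p n)" if "1 \<le> n" for n
    using assms(3) that by blast
  \<comment> \<open>Partitions are only given for positive indices; at index 0 the event is empty,
    since \<open>exceedances\<close> contains positive integers only.\<close>
  have A: "{\<omega> \<in> space M. n \<in> ?A e \<omega>} \<in> events" for n e
  proof (cases "1 \<le> n")
    case True
    note [measurable] = square_sum_measurable[OF part[OF True]]
    show ?thesis
      using True by (simp add: exceedances_def)
  next
    case False
    then show ?thesis
      by (simp add: exceedances_def)
  qed
  have A0: "0 \<notin> ?A e \<omega>" for e \<omega>
    by (simp add: exceedances_def)
  have cheb: "emeasure M {\<omega> \<in> space M. n \<in> ?A e \<omega>} \<le> ennreal (2 * t / (e n)\<^sup>2 * mesh (k n) (p n))"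
    if "1 \<le> n" "0 < e n" for n e
    using square_sum_Chebyshev[OF part[OF that(1)] that(2)] that
    by (simp add: emeasure_eq_measure exceedances_def ennreal_leI)
  have card_le: "enat_card (?A e \<omega>) \<le> last_index (?A e \<omega>)" for e \<omega>
    by (rule enat_card_le_last_index[OF A0])
  have last_ev: "{\<omega> \<in> space M. enat j \<le> last_index (?A e \<omega>)} \<in> events" if "1 \<le> j" for e j
    by (rule sets_last_index_ge[OF A that])
  have card_sub: "{\<omega> \<in> space M. enat j \<le> enat_card (?A e \<omega>)}
      \<subseteq> {\<omega> \<in> space M. enat j \<le> last_index (?A e \<omega>)}" for e j
    using card_le order_trans by blast
  have pred_sub: "{\<omega> \<in> space M. enat j \<le> last_pred (?A e \<omega>)}
      \<subseteq> {\<omega> \<in> space M. enat j \<le> last_index (?A e \<omega>)}" for e j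
    using last_pred_le_last_index order_trans by blast
  have 1: "AE \<omega> in M. (\<lambda>n. square_sum W (k n) (p n) \<omega>) \<longlonglongrightarrow> t"
  proof -
    \<comment> \<open>The convergence lemma wants a partition at every index, so it is applied to
      the sequence shifted by one.\<close>
    have "AE \<omega> in M. (\<lambda>n. square_sum W (k (Suc n)) (p (Suc n)) \<omega>) \<longlonglongrightarrow> t"
      using AE_square_sum_tendsto[of t "\<lambda>n. k (Suc n)" "\<lambda>n. p (Suc n)", OF part assms(6)] by simp
    then show ?thesis
      by eventually_elim (rule LIMSEQ_imp_Suc)
  qed
  have 2: "(\<integral>\<^sup>+\<omega>. partial_sum a (last_index (?A (\<lambda>_. \<epsilon>) \<omega>)) \<partial>M)
      \<le> ennreal (2 * t / \<epsilon>\<^sup>2) * weighted_tails a (\<lambda>n. mesh (k n) (p n))"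
    if "0 < \<epsilon>" for a \<epsilon>
  proof (rule nn_integral_partial_sum_last_index[OF A])
    fix n :: nat assume n: "1 \<le> n"
    show "emeasure M {\<omega> \<in> space M. n \<in> ?A (\<lambda>_. \<epsilon>) \<omega>}
        \<le> ennreal (2 * t / \<epsilon>\<^sup>2) * ennreal (mesh (k n) (p n))"
      using cheb[OF n, of "\<lambda>_. \<epsilon>"] that assms(2) mesh_pos[OF part[OF n]]
      by (simp flip: ennreal_mult)
  qed
  have 3: "emeasure M {\<omega> \<in> space M. enat j \<le> last_index (?A (\<lambda>_. \<epsilon>) \<omega>)}
      \<le> ennreal (2 * t / \<epsilon>\<^sup>2) * weighted_tails a (\<lambda>n. mesh (k n) (p n)) / partial_sum a (enat j)"
    if "\<forall>n\<ge>1. 0 < a n" "0 < \<epsilon>" "1 \<le> j" for a \<epsilon> j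
    using that
    by (intro order_trans[OF emeasure_last_index_ge_partial_sum[OF A, where a = a]] divide_right_mono_ennreal 2)
      auto
  have powr_bound: "emeasure M {\<omega> \<in> space M. n \<in> ?A e \<omega>} \<le> ennreal (real n powr - \<theta>)"
    if e: "\<forall>n\<ge>1. e n = sqrt (2 * t * real n powr \<theta> * mesh (k n) (p n))" and n: "1 \<le> n" for e \<theta> n
  proof -
    \<comment> \<open>The tolerance is calibrated so that the Chebyshev bound collapses to
      \<open>real n powr - \<theta>\<close>. Positivity of the radicand gives \<open>e n > 0\<close>
      and lets the square undo the root.\<close>
    have pos: "0 < 2 * t * real n powr \<theta> * mesh (k n) (p n)"
      using assms(2) n mesh_pos[OF part[OF n]] by simp
    then have "2 * t / (e n)\<^sup>2 * mesh (k n) (p n) = real n powr - \<theta>"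
      using e n assms(2) mesh_pos[OF part[OF n]] by (simp add: powr_minus field_simps)
    then show ?thesis
      using cheb[of n e] pos e n by simp
  qed
  have 4: "measure M {\<omega> \<in> space M. enat j \<le> enat_card (?A e \<omega>)} \<le> zeta \<theta> / real j"
    if e: "\<forall>n\<ge>1. e n = sqrt (2 * t * real n powr \<theta> * mesh (k n) (p n))" and "1 < \<theta>" "1 \<le> j" for e \<theta> j
  proof -
    have "of_nat j * emeasure M {\<omega> \<in> space M. enat j \<le> enat_card (?A e \<omega>)}
        \<le> (\<Sum>n. emeasure M {\<omega> \<in> space M. Suc n \<in> ?A e \<omega>})"
      by (rule emeasure_enat_card_ge[OF A A0])
    also have "\<dots> \<le> (\<Sum>n. ennreal (real (Suc n) powr - \<theta>))"
      by (intro suminf_le powr_bound[OF e]) auto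
    also have "\<dots> = ennreal (zeta \<theta>)"
      by (rule suminf_powr_eq_zeta[OF that(2)])
    finally have "real j * measure M {\<omega> \<in> space M. enat j \<le> enat_card (?A e \<omega>)} \<le> zeta \<theta>"
      using zeta_nonneg[OF that(2)]
      by (simp add: emeasure_eq_measure ennreal_of_nat_eq_real_of_nat flip: ennreal_mult)
    then show ?thesis
      using that(3) by (simp add: field_simps)
  qed
  have 5: "measure M {\<omega> \<in> space M. enat j \<le> last_index (?A e \<omega>)}
      \<le> real j powr (- (q + 1)) * (\<theta> * zeta (\<theta> - q - 1) + (if q < 0 then 1 else 0))"
    if e: "\<forall>n\<ge>1. e n = sqrt (2 * t * real n powr \<theta> * mesh (k n) (p n))"
      and \<theta>: "1 < \<theta>" and q: "-1 < q" "q < \<theta> - 2" and j: "1 \<le> j" for e \<theta> q j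
  proof -
    have zeta: "0 \<le> zeta (\<theta> - q - 1)"
      using q by (intro zeta_nonneg) simp
    have "emeasure M {\<omega> \<in> space M. enat j \<le> last_index (?A e \<omega>)}
        \<le> (\<Sum>m. emeasure M {\<omega> \<in> space M. j + m \<in> ?A e \<omega>})"
      by (rule emeasure_last_index_ge[OF A j])
    also have "\<dots> \<le> (\<Sum>m. ennreal (real (j + m) powr - \<theta>))"
      using j by (intro suminf_le powr_bound[OF e]) auto
    \<comment> \<open>The tail bound is used with \<open>r = q + 1\<close>: the condition
      \<open>-1 < q\<close> makes \<open>r\<close> nonnegative, and \<open>q < \<theta> - 2\<close>
      puts the remaining exponent \<open>\<theta> - r\<close> above 1.\<close>
    also have "\<dots> \<le> ennreal (real j powr - (q + 1) * zeta (\<theta> - (q + 1)))"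
      using j q by (intro suminf_powr_tail_le) auto
    finally have "measure M {\<omega> \<in> space M. enat j \<le> last_index (?A e \<omega>)}
        \<le> real j powr - (q + 1) * zeta (\<theta> - q - 1)"
      using zeta by (simp add: emeasure_eq_measure diff_diff_eq)
    \<comment> \<open>The bracket only grows: \<open>\<theta>\<close> exceeds 1, the zeta value is
      nonnegative, and the case term is 0 or 1.\<close>
    also have "\<dots> \<le> real j powr - (q + 1) * (\<theta> * zeta (\<theta> - q - 1) + (if q < 0 then 1 else 0))"
    proof (intro mult_left_mono)
      have "1 * zeta (\<theta> - q - 1) \<le> \<theta> * zeta (\<theta> - q - 1)"
        using \<theta> zeta by (intro mult_right_mono) auto
      then show "zeta (\<theta> - q - 1) \<le> \<theta> * zeta (\<theta> - q - 1) + (if q < 0 then 1 else 0)"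
        by simp
    qed simp
    finally show ?thesis .
  qed
  show ?thesis
    apply (intro conjI allI impI; (elim conjE)?)
    subgoal by (rule 1)
    subgoal by (intro nn_integral_mono partial_sum_mono card_le)
    subgoal by (intro nn_integral_mono partial_sum_mono last_pred_le_last_index)
    subgoal by (rule 2)
    subgoal by (rule emeasure_mono[OF card_sub last_ev])
    subgoal by (rule emeasure_mono[OF pred_sub last_ev])
    subgoal by (rule 3)
    subgoal by (rule 4)
    subgoal by (rule finite_measure_mono[OF card_sub last_ev])
    subgoal by (rule finite_measure_mono[OF pred_sub last_ev])
    subgoal by (rule 5)
    done
qed

end
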